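(* There exists a recursive coloring function $c:\mathbb{N}\rightarrow r$ (for some natural number $r\geq 2$) such that for every infinite $\Delta^0_3$ set $A\subseteq\mathbb{Z}^+$ with weak apartness, there exist $x\ll w_1\ll w_2$ in $A$ such that $c(w_1+w_2)\neq c(x+w_1+w_2)$. Hence $FS^{\leq 3}(A)$ is not monochromatic under $c$.
   Context: For $x=\sum_{i=0}^{k}2^{n_i}\in\mathbb{Z}^+$ with $n_0<\cdots<n_k$, set $\mu(x)=n_k$ and $\lambda(x)=n_0$. For positive integers $x<y$, write $x\ll y$ if $\mu(x)<\lambda(y)$. For each $n$, $B^n=\{x\in\mathbb{Z}^+:\mu(x)=n\}$. A set $A$ has weak apartness if for every natural number $m$, $B^m\cap A$ has at most one element, and for every natural number $l$, there are at most two $x\in A$ with $\lambda(x)=l$. $FS^{\leq 3}(A)=\{\sum_{x\in F}x: F\subseteq A,\ F \text{ nonempty},\ |F|\leq 3\}$. *)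

theory Defs
  imports Main
begin

datatype recf = Zero | Succ | Proj nat | Comp recf "recf list" | Prec recf recf | Mini recf

inductive eval :: "recf \<Rightarrow> nat list \<Rightarrow> nat \<Rightarrow> bool" where
  eval_Zero: "eval Zero xs 0"
| eval_Succ: "eval Succ (x # xs) (Suc x)"
| eval_Proj: "i < length xs \<Longrightarrow> eval (Proj i) xs (xs ! i)"
| eval_Comp: "length ys = length gs \<Longrightarrow> (\<forall>i < length gs. eval (gs ! i) xs (ys ! i))
      \<Longrightarrow> eval f ys z \<Longrightarrow> eval (Comp f gs) xs z"
| eval_Prec0: "eval f xs z \<Longrightarrow> eval (Prec f g) (0 # xs) z"
| eval_PrecS: "eval (Prec f g) (n # xs) y \<Longrightarrow> eval g (y # n # xs) z
      \<Longrightarrow> eval (Prec f g) (Suc n # xs) z"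
| eval_Mini: "eval f (n # xs) 0 \<Longrightarrow> (\<forall>m < n. \<exists>y. eval f (m # xs) y \<and> y \<noteq> 0)
      \<Longrightarrow> eval (Mini f) xs n"

definition recursive_fun :: "(nat \<Rightarrow> nat) \<Rightarrow> bool" where
  "recursive_fun c \<longleftrightarrow> (\<exists>t. \<forall>n. eval t [n] (c n))"

definition recursive_rel4 :: "(nat \<Rightarrow> nat \<Rightarrow> nat \<Rightarrow> nat \<Rightarrow> bool) \<Rightarrow> bool" where
  "recursive_rel4 P \<longleftrightarrow>
     (\<exists>t. \<forall>x a b d. eval t [x, a, b, d] (if P x a b d then 1 else 0))"

definition Sigma3 :: "nat set \<Rightarrow> bool" where
  "Sigma3 A \<longleftrightarrow> (\<exists>P. recursive_rel4 P \<and> (\<forall>x. x \<in> A \<longleftrightarrow> (\<exists>a. \<forall>b. \<exists>d. P x a b d)))"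

definition Pi3 :: "nat set \<Rightarrow> bool" where
  "Pi3 A \<longleftrightarrow> (\<exists>P. recursive_rel4 P \<and> (\<forall>x. x \<in> A \<longleftrightarrow> (\<forall>a. \<exists>b. \<forall>d. P x a b d)))"

definition Delta3 :: "nat set \<Rightarrow> bool" where
  "Delta3 A \<longleftrightarrow> Sigma3 A \<and> Pi3 A"

definition mu :: "nat \<Rightarrow> nat" where
  "mu x = Max {n. bit x n}"

definition lam :: "nat \<Rightarrow> nat" where
  "lam x = Min {n. bit x n}"

definition ll :: "nat \<Rightarrow> nat \<Rightarrow> bool" (infix "\<lless>" 50) where
  "x \<lless> y \<longleftrightarrow> x < y \<and> mu x < lam y"

definition weak_apart :: "nat set \<Rightarrow> bool" where
  "weak_apart A \<longleftrightarrow>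
     (\<forall>m. \<forall>x \<in> A. \<forall>y \<in> A. mu x = m \<and> mu y = m \<longrightarrow> x = y) \<and>
     (\<forall>l. finite {x \<in> A. lam x = l} \<and> card {x \<in> A. lam x = l} \<le> 2)"

definition FS3 :: "nat set \<Rightarrow> nat set" where
  "FS3 A = {\<Sum>F | F. F \<subseteq> A \<and> F \<noteq> {} \<and> finite F \<and> card F \<le> 3}"

end

theory Submission
  imports Defs "HOL-Library.Infinite_Set" "HOL-Library.Nat_Bijection"
begin

text \<open>
  The double limit lemma approximates every \<open>\<Delta>\<^sub>3\<close> set by a recursive family with two stages
  \<open>j\<close> and \<open>t\<close>.  A sum \<open>n = x + w\<^sub>1 + w\<^sub>2\<close> does not show where its summands begin and end, but
  \<open>t = \<mu> n = \<mu> w\<^sub>2\<close> can be read off, and \<open>j = \<lambda> w\<^sub>1\<close> is the bit of \<open>n\<close> that follows the bit \<open>\<mu> x\<close>.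
  So we mark pairs \<open>(i, j)\<close> of bit positions, depending on \<open>t\<close>, and color \<open>n\<close> by the parity of the
  number of marked pairs among its pairs of consecutive bits.  Putting \<open>x\<close> in front of
  \<open>w\<^sub>1 + w\<^sub>2\<close> adds the pairs inside \<open>x\<close> and the pair \<open>(\<mu> x, \<lambda> w\<^sub>1)\<close>; hence the color changes as
  soon as that pair is marked exactly when the number of marked pairs inside \<open>x\<close> is even.

  To achieve this, at stages \<open>j\<close> and \<open>t\<close> the \<open>e\<close>-th set wants its (approximate) first \<open>2\<^sup>e\<close>
  elements to be served, and position \<open>i\<close> goes to the least \<open>e\<close> that wants some \<open>x\<close> with
  \<open>\<mu> x = i\<close>.  Fewer than \<open>2\<^sup>e\<close> positions are taken by smaller indices, and the first \<open>2\<^sup>e\<close>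
  elements of the \<open>e\<close>-th set have distinct \<open>\<mu>\<close>, so one of them is served.  Which one may depend on
  \<open>j\<close> and \<open>t\<close>, since the smaller indices need not stabilize; therefore \<open>x\<close> is chosen after
  \<open>w\<^sub>1\<close> and \<open>w\<^sub>2\<close>.
\<close>

subsection \<open>Closure properties of computable functions\<close>

text \<open>
  An environment \<open>v\<close> assigns values to the variables \<open>0, 1, \<dots>\<close>; programs see a sufficiently long
  initial segment of it, so arities never have to be mentioned.  A binder shifts the environment
  and makes the bound variable number 0.
\<close>

definition computable :: "((nat \<Rightarrow> nat) \<Rightarrow> nat) \<Rightarrow> bool" where
  "computable f \<longleftrightarrow> (\<forall>\<^sub>F n in sequentially. \<exists>t. \<forall>v. eval t (map v [0..<n]) (f v))"

definition decidable :: "((nat \<Rightarrow> nat) \<Rightarrow> bool) \<Rightarrow> bool" where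
  "decidable P \<longleftrightarrow> computable (\<lambda>v. of_bool (P v))"

named_theorems computable_intros

lemma computable_Comp:
  assumes prog: "\<And>v. eval t (map (\<lambda>f. f v) fs) (g v)"
    and args: "\<And>f. f \<in> set fs \<Longrightarrow> computable f"
  shows "computable g"
proof -
  have "\<forall>\<^sub>F n in sequentially. \<forall>f\<in>set fs. \<exists>u. \<forall>v. eval u (map v [0..<n]) (f v)"
    using args unfolding computable_def by (intro eventually_ball_finite) auto
  then show ?thesis
    unfolding computable_def
  proof eventually_elim
    case (elim n)
    then obtain u where u: "\<And>f v. f \<in> set fs \<Longrightarrow> eval (u f) (map v [0..<n]) (f v)" by metis
    have "eval (Comp t (map u fs)) (map v [0..<n]) (g v)" for v
      by (rule eval_Comp[where ys = "map (\<lambda>f. f v) fs"]) (use prog u in auto)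
    then show ?case by blast
  qed
qed

lemma computable_program:
  assumes "computable f"
  shows "\<exists>n t. \<forall>v. eval t (map v [0..<n]) (f v)"
  using eventually_happens[OF assms[unfolded computable_def]] by simp

lemma computable_var [computable_intros]: "computable (\<lambda>v. v i)"
proof -
  have "\<exists>t. \<forall>v. eval t (map v [0..<n]) (v i)" if "i < n" for n
    using eval_Proj[of i "map _ [0..<n]"] that by auto
  then show ?thesis
    unfolding computable_def using eventually_gt_at_top by (rule eventually_mono[rotated])
qed

lemma computable_subst:
  assumes "computable f" and h: "\<And>i. computable (\<lambda>v. h v i)"
  shows "computable (\<lambda>v. f (h v))"
proof -
  from assms(1) obtain n t where t: "\<And>v. eval t (map v [0..<n]) (f v)"
    using computable_program by blast
  show ?thesis
    by (rule computable_Comp[of t "map (\<lambda>i v. h v i) [0..<n]"]) (use t h in \<open>auto simp: comp_def\<close>)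
qed

lemma computable_shift: "computable f \<Longrightarrow> computable (\<lambda>v. f (\<lambda>i. v (Suc i)))"
  using computable_subst[of f "\<lambda>v i. v (Suc i)"] computable_var by blast

lemma computable_case_nat:
  assumes "computable a" "\<And>i. computable (\<lambda>v. h v i)"
  shows "computable (\<lambda>v. case_nat (a v) (h v) i)"
  using assms by (cases i) auto

lemma computable_subst1:
  assumes "computable (\<lambda>v. f (v 0))" "computable a"
  shows "computable (\<lambda>v. f (a v))"
  using computable_subst[OF assms(1), of "\<lambda>v _. a v"] assms(2) by simp

lemma computable_subst2:
  assumes "computable (\<lambda>v. f (v 0) (v 1))" "computable a" "computable b"
  shows "computable (\<lambda>v. f (a v) (b v))"
  using computable_subst[OF assms(1), of "\<lambda>v. case_nat (a v) (\<lambda>_. b v)"] assms(2,3)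
  by (simp add: computable_case_nat)

lemma computable_subst4:
  assumes "computable (\<lambda>v. f (v 0) (v 1) (v 2) (v 3))"
    and "computable a" "computable b" "computable c" "computable d"
  shows "computable (\<lambda>v. f (a v) (b v) (c v) (d v))"
  using computable_subst[OF assms(1),
      of "\<lambda>v. case_nat (a v) (case_nat (b v) (case_nat (c v) (\<lambda>_. d v)))"] assms(2-)
  by (simp add: computable_case_nat numeral_2_eq_2 numeral_3_eq_3)

lemma decidable_subst3:
  assumes "decidable (\<lambda>v. P (v 0) (v 1) (v 2))" "computable a" "computable b" "computable c"
  shows "decidable (\<lambda>v. P (a v) (b v) (c v))"
  using computable_subst4[of "\<lambda>x y z _. of_bool (P x y z)" a b c a] assms
  unfolding decidable_def by blast

lemma decidable_subst4:
  assumes "decidable (\<lambda>v. P (v 0) (v 1) (v 2) (v 3))"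
    and "computable a" "computable b" "computable c" "computable d"
  shows "decidable (\<lambda>v. P (a v) (b v) (c v) (d v))"
  using computable_subst4[of "\<lambda>x y z w. of_bool (P x y z w)"] assms
  unfolding decidable_def by blast

lemma decidable_recursive_rel4:
  assumes "recursive_rel4 P" "computable a" "computable b" "computable c" "computable d"
  shows "decidable (\<lambda>v. P (a v) (b v) (c v) (d v))"
proof -
  from assms(1) obtain t where "\<And>x a b d. eval t [x, a, b, d] (of_bool (P x a b d))"
    unfolding recursive_rel4_def of_bool_def by blast
  with assms(2-) show ?thesis
    unfolding decidable_def by - (rule computable_Comp[of t "[a, b, c, d]"], auto)
qed

lemma computable_const [computable_intros]: "computable (\<lambda>_. k)"
proof (induction k)
  case 0
  show ?case by (rule computable_Comp[of Zero "[]"]) (auto intro: eval_Zero)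
next
  case (Suc k)
  then show ?case
    by - (rule computable_Comp[of Succ "[\<lambda>_. k]"], auto intro: eval_Succ)
qed

lemma computable_Suc [computable_intros]: "computable a \<Longrightarrow> computable (\<lambda>v. Suc (a v))"
  by (rule computable_Comp[of Succ "[a]"]) (auto intro: eval_Succ)

lemma computable_program_list:
  assumes "computable f"
  shows "\<exists>t. \<forall>xs. length xs = k \<longrightarrow> eval t xs (f (\<lambda>i. if i < k then xs ! i else 0))"
proof -
  from assms obtain n t where t: "\<And>v. eval t (map v [0..<n]) (f v)"
    using computable_program by blast
  let ?u = "Comp t (map (\<lambda>i. if i < k then Proj i else Zero) [0..<n])"
  have "eval ?u xs (f (\<lambda>i. if i < k then xs ! i else 0))" if "length xs = k" for xs
    by (rule eval_Comp[OF _ _ t]) (use that in \<open>auto intro: eval_Proj eval_Zero\<close>)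
  then show ?thesis by blast
qed

lemma recursive_funI:
  assumes "computable (\<lambda>v. f (v 0))"
  shows "recursive_fun f"
proof -
  obtain t where "\<And>xs. length xs = 1 \<Longrightarrow> eval t xs (f (xs ! 0))"
    using computable_program_list[OF assms, of 1] by auto
  from this[of "[_]"] show ?thesis unfolding recursive_fun_def by auto
qed

lemma recursive_rel4I:
  assumes "decidable (\<lambda>v. P (v 0) (v 1) (v 2) (v 3))"
  shows "recursive_rel4 P"
proof -
  obtain t where "\<And>xs. length xs = 4 \<Longrightarrow>
      eval t xs (of_bool (P (xs ! 0) (xs ! 1) (xs ! 2) (xs ! 3)))"
    using computable_program_list[OF assms[unfolded decidable_def], of 4] by auto
  from this[of "[_, _, _, _]"]
  have "\<forall>x a b d. eval t [x, a, b, d] (of_bool (P x a b d))" by simp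
  then show ?thesis unfolding recursive_rel4_def of_bool_def by blast
qed

lemma computable_rec_nat:
  assumes init: "computable f"
    and step: "computable (\<lambda>v. g (v (Suc 0)) (v 0) (\<lambda>i. v (Suc (Suc i))))"
    and arg: "computable b"
  shows "computable (\<lambda>v. rec_nat (f v) (\<lambda>m y. g m y v) (b v))"
proof -
  have "\<forall>\<^sub>F n in sequentially. \<exists>u. \<forall>v.
      eval u (map v [0..<Suc (Suc n)]) (g (v (Suc 0)) (v 0) (\<lambda>i. v (Suc (Suc i))))"
    using step unfolding computable_def
    by (rule eventually_sequentially_seg[THEN iffD2, of _ 2, unfolded numeral_2_eq_2, simplified])
  from eventually_happens[OF eventually_conj[OF init[unfolded computable_def] this]]
  obtain n t u where t: "\<And>v. eval t (map v [0..<n]) (f v)"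
    and u: "\<And>v. eval u (map v [0..<Suc (Suc n)]) (g (v (Suc 0)) (v 0) (\<lambda>i. v (Suc (Suc i))))"
    by auto
  have "eval u (y # m # map v [0..<n]) (g m y v)" for m y v
    using u[of "case_nat y (case_nat m v)"] by (simp add: map_upt_Suc del: upt_Suc)
  then have "eval (Prec t u) (k # map v [0..<n]) (rec_nat (f v) (\<lambda>m y. g m y v) k)" for k v
    by (induction k) (use t in \<open>auto intro: eval_Prec0 eval_PrecS\<close>)
  with arg show ?thesis
    by - (rule computable_Comp[of "Prec t u" "b # map (\<lambda>i v. v i) [0..<n]"],
        auto simp: comp_def intro: computable_var)
qed

lemma computable_add [computable_intros]:
  assumes "computable a" "computable b"
  shows "computable (\<lambda>v. a v + b v)"
proof (rule computable_subst2[OF _ assms])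
  have "a + b = rec_nat a (\<lambda>_. Suc) b" for a b :: nat by (induction b) auto
  then show "computable (\<lambda>v. v 0 + v 1)"
    by (simp only:) (intro computable_rec_nat computable_intros)
qed

lemma computable_mult [computable_intros]:
  assumes "computable a" "computable b"
  shows "computable (\<lambda>v. a v * b v)"
proof (rule computable_subst2[OF _ assms])
  have "a * b = rec_nat 0 (\<lambda>_ y. y + a) b" for a b :: nat by (induction b) auto
  then show "computable (\<lambda>v. v 0 * v 1)"
    by (simp only:) (intro computable_rec_nat computable_intros)
qed

lemma computable_power [computable_intros]:
  assumes "computable a" "computable b"
  shows "computable (\<lambda>v. a v ^ b v)"
proof (rule computable_subst2[OF _ assms])
  have "a ^ b = rec_nat 1 (\<lambda>_ y. y * a) b" for a b :: nat by (induction b) auto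
  then show "computable (\<lambda>v. v 0 ^ v 1)"
    by (simp only:) (intro computable_rec_nat computable_intros)
qed

lemma computable_diff [computable_intros]:
  assumes "computable a" "computable b"
  shows "computable (\<lambda>v. a v - b v)"
proof (rule computable_subst2[OF _ assms])
  have pred: "y - 1 = rec_nat 0 (\<lambda>m _. m) y" for y :: nat by (induction y) auto
  have "a - b = rec_nat a (\<lambda>_ y. rec_nat 0 (\<lambda>m _. m) y) b" for a b :: nat
    by (induction b) (auto simp flip: pred)
  then show "computable (\<lambda>v. v 0 - v 1)"
    by (simp only:) (intro computable_rec_nat computable_intros)
qed

lemma computable_sum [computable_intros]:
  assumes "computable b" "computable (\<lambda>v. f (v 0) (\<lambda>i. v (Suc i)))"
  shows "computable (\<lambda>v. \<Sum>k<b v. f k v)"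
proof -
  have "(\<Sum>k<b. f k v) = rec_nat 0 (\<lambda>k y. y + f k v) b" for b v by (induction b) auto
  then show ?thesis
    using assms computable_shift[OF assms(2)]
    by (simp only:) (intro computable_rec_nat computable_intros)
qed

lemma computable_of_bool [computable_intros]:
  "decidable P \<Longrightarrow> computable (\<lambda>v. of_bool (P v))"
  by (simp add: decidable_def)

lemma decidable_not [computable_intros]:
  assumes "decidable P"
  shows "decidable (\<lambda>v. \<not> P v)"
proof -
  have "of_bool (\<not> p) = 1 - (of_bool p :: nat)" for p by simp
  then show ?thesis
    unfolding decidable_def using assms by (simp only:) (intro computable_intros)
qed

lemma decidable_conj [computable_intros]:
  assumes "decidable P" "decidable Q"
  shows "decidable (\<lambda>v. P v \<and> Q v)"
  unfolding decidable_def of_bool_conj using assms by (intro computable_intros)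

lemma decidable_disj [computable_intros]:
  assumes "decidable P" "decidable Q"
  shows "decidable (\<lambda>v. P v \<or> Q v)"
proof -
  have "decidable (\<lambda>v. \<not> (\<not> P v \<and> \<not> Q v))"
    using assms by (intro computable_intros)
  then show ?thesis by simp
qed

lemma decidable_imp [computable_intros]:
  "decidable P \<Longrightarrow> decidable Q \<Longrightarrow> decidable (\<lambda>v. P v \<longrightarrow> Q v)"
  unfolding imp_conv_disj by (intro computable_intros)

lemma decidable_less [computable_intros]:
  assumes "computable a" "computable b"
  shows "decidable (\<lambda>v. a v < b v)"
proof -
  have "of_bool (a < b) = 1 - (1 - (b - a))" for a b :: nat by auto
  then show ?thesis
    unfolding decidable_def using assms by (simp only:) (intro computable_intros)
qed

lemma decidable_le [computable_intros]:
  "computable a \<Longrightarrow> computable b \<Longrightarrow> decidable (\<lambda>v. a v \<le> b v)"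
  unfolding not_less[symmetric] by (intro computable_intros)

lemma decidable_eq [computable_intros]:
  "computable a \<Longrightarrow> computable b \<Longrightarrow> decidable (\<lambda>v. a v = b v)"
  unfolding order_eq_iff by (intro computable_intros)

lemma decidable_bex [computable_intros]:
  assumes "computable b" "decidable (\<lambda>v. P (v 0) (\<lambda>i. v (Suc i)))"
  shows "decidable (\<lambda>v. \<exists>k<b v. P k v)"
proof -
  have "decidable (\<lambda>v. 0 < (\<Sum>k<b v. of_bool (P k v) :: nat))"
    using assms by (intro computable_intros)
  moreover have "0 < (\<Sum>k<b. of_bool (P k v) :: nat) \<longleftrightarrow> (\<exists>k<b. P k v)" for b v
    by (induction b) (auto simp: less_Suc_eq)
  ultimately show ?thesis by simp
qed

lemma decidable_ball [computable_intros]: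
  assumes "computable b" "decidable (\<lambda>v. P (v 0) (\<lambda>i. v (Suc i)))"
  shows "decidable (\<lambda>v. \<forall>k<b v. P k v)"
proof -
  have "decidable (\<lambda>v. \<not> (\<exists>k<b v. \<not> P k v))"
    using assms by (intro computable_intros)
  then show ?thesis by simp
qed

lemma computable_if_decidable_graph:
  assumes "decidable (\<lambda>v. v 0 = f (\<lambda>i. v (Suc i)))" "computable b" "\<And>v. f v \<le> b v"
  shows "computable f"
proof -
  have "f v = (\<Sum>k<Suc (b v). of_bool (k = f v) * k)" for v
    using assms(3)[of v]
    by (simp add: of_bool_def if_distrib if_distribR less_Suc_eq_le cong: if_cong
        del: sum.lessThan_Suc)
  moreover have "computable (\<lambda>v. \<Sum>k<Suc (b v). of_bool (k = f v) * k)"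
    using assms(1,2)
    by (intro computable_sum computable_mult computable_of_bool computable_Suc computable_var)
  ultimately show ?thesis by simp
qed

lemma computable_div [computable_intros]:
  assumes "computable a" "computable b"
  shows "computable (\<lambda>v. a v div b v)"
proof (rule computable_subst2[OF _ assms], rule computable_if_decidable_graph[where b = "\<lambda>v. v 0"])
  have "k = a div b \<longleftrightarrow> b = 0 \<and> k = 0 \<or> 0 < b \<and> k * b \<le> a \<and> a < Suc k * b"
    for k a b :: nat
    by (cases "b = 0")
      (auto simp: mult.commute dividend_less_times_div div_times_less_eq_dividend
        intro!: div_nat_eqI[symmetric])
  then show "decidable (\<lambda>v. v 0 = v (Suc 0) div v (Suc 1))"
    by (simp only:) (intro computable_intros)
qed (auto intro: computable_intros)

lemma decidable_even [computable_intros]: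
  assumes "computable a"
  shows "decidable (\<lambda>v. even (a v))"
proof -
  have "even a \<longleftrightarrow> a = 2 * (a div 2)" for a :: nat by presburger
  then show ?thesis
    using assms by (simp only:) (intro computable_intros)
qed

lemma decidable_set_decode [computable_intros]:
  "computable a \<Longrightarrow> computable b \<Longrightarrow> decidable (\<lambda>v. a v \<in> set_decode (b v))"
  unfolding set_decode_def mem_Collect_eq by (intro computable_intros)

lemma computable_set_encode [computable_intros]:
  assumes "computable b" "decidable (\<lambda>v. P (v 0) (\<lambda>i. v (Suc i)))"
  shows "computable (\<lambda>v. set_encode {k. k < b v \<and> P k v})"
proof -
  have "set_encode {k. k < b \<and> P k v} = (\<Sum>k<b. of_bool (P k v) * 2 ^ k)" for b v
    unfolding set_encode_def
    by (simp add: lessThan_def[symmetric] sum.inter_filter[symmetric] Collect_conj_eq)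
  then show ?thesis
    using assms by (simp only:) (intro computable_intros)
qed

lemma decidable_course_of_values:
  assumes step: "decidable (\<lambda>v. R (v 0) (v (Suc 0)) (\<lambda>i. v (Suc (Suc i))))"
    and rec: "\<And>k v. Q k v \<longleftrightarrow> R (set_encode {i. i < k \<and> Q i v}) k v"
    and arg: "computable b"
  shows "decidable (\<lambda>v. Q (b v) v)"
proof -
  let ?H = "\<lambda>v k. rec_nat 0 (\<lambda>k H. H + of_bool (R H k v) * 2 ^ k) k"
  have history: "set_encode {i. i < k \<and> Q i v} = ?H v k" for k v
  proof (induction k)
    case (Suc k)
    have "{i. i < Suc k \<and> Q i v} =
        (if Q k v then insert k {i. i < k \<and> Q i v} else {i. i < k \<and> Q i v})"
      by (auto simp: less_Suc_eq)
    then show ?case using rec[of k v] Suc by simp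
  qed simp
  have "computable (\<lambda>v. ?H v (b v))"
    using step arg by (intro computable_rec_nat computable_intros)
  then have "computable (\<lambda>v. case_nat (?H v (b v)) (case_nat (b v) v) i)" for i
    using arg by (intro computable_case_nat computable_var)
  from computable_subst[OF step[unfolded decidable_def],
      of "\<lambda>v. case_nat (?H v (b v)) (case_nat (b v) v)", OF this]
  have "decidable (\<lambda>v. R (?H v (b v)) (b v) v)" by (simp add: decidable_def)
  then show ?thesis by (simp add: rec[symmetric] flip: history)
qed

abbreviation pfst :: "nat \<Rightarrow> nat" where "pfst k \<equiv> fst (prod_decode k)"
abbreviation psnd :: "nat \<Rightarrow> nat" where "psnd k \<equiv> snd (prod_decode k)"

lemma computable_prod_encode [computable_intros]:
  "computable a \<Longrightarrow> computable b \<Longrightarrow> computable (\<lambda>v. prod_encode (a v, b v))"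
  unfolding prod_encode_def triangle_def split_conv by (intro computable_intros)

lemma computable_pfst [computable_intros]:
  assumes "computable a"
  shows "computable (\<lambda>v. pfst (a v))"
proof (rule computable_subst1[OF _ assms], rule computable_if_decidable_graph)
  have "k = pfst n \<longleftrightarrow> (\<exists>b<Suc n. prod_encode (k, b) = n)" for k n
    using surj_prod_encode[THEN surjD, of n] by (auto simp: less_Suc_eq_le le_prod_encode_2)
  then show "decidable (\<lambda>v. v 0 = pfst (v (Suc 0)))"
    by (simp only:) (intro computable_intros)
  show "pfst (v 0) \<le> v 0" for v
    using le_prod_encode_1[of "pfst (v 0)" "psnd (v 0)"] by simp
qed (rule computable_var)

lemma computable_psnd [computable_intros]:
  assumes "computable a"
  shows "computable (\<lambda>v. psnd (a v))"
proof (rule computable_subst1[OF _ assms], rule computable_if_decidable_graph)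
  have "k = psnd n \<longleftrightarrow> (\<exists>a<Suc n. prod_encode (a, k) = n)" for k n
    using surj_prod_encode[THEN surjD, of n] by (auto simp: less_Suc_eq_le le_prod_encode_1)
  then show "decidable (\<lambda>v. v 0 = psnd (v (Suc 0)))"
    by (simp only:) (intro computable_intros)
  show "psnd (v 0) \<le> v 0" for v
    using le_prod_encode_2[of "psnd (v 0)" "pfst (v 0)"] by simp
qed (rule computable_var)

subsection \<open>Binary expansions\<close>

lemma set_decode_eq_bits: "set_decode n = {k. bit n k}"
  by (simp add: set_decode_def bit_iff_odd)

lemma mu_eq_Max: "mu n = Max (set_decode n)"
  by (simp add: mu_def set_decode_eq_bits)

lemma lam_eq_Min: "lam n = Min (set_decode n)"
  by (simp add: lam_def set_decode_eq_bits)

lemma set_decode_eq_empty_iff [simp]: "set_decode n = {} \<longleftrightarrow> n = 0"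
  by (metis set_decode_inverse set_decode_zero set_encode_empty)

lemma exp_le_if_mem_set_decode: "k \<in> set_decode n \<Longrightarrow> 2 ^ k \<le> n"
  by (metis set_decode_def mem_Collect_eq div_less even_zero not_le)

lemma less_if_mem_set_decode: "k \<in> set_decode n \<Longrightarrow> k < n"
  using exp_le_if_mem_set_decode less_exp less_le_trans by blast

lemma mu_mem: "0 < n \<Longrightarrow> mu n \<in> set_decode n"
  by (simp add: mu_eq_Max)

lemma lam_mem: "0 < n \<Longrightarrow> lam n \<in> set_decode n"
  by (simp add: lam_eq_Min)

lemma le_mu: "k \<in> set_decode n \<Longrightarrow> k \<le> mu n"
  by (simp add: mu_eq_Max)

lemma lam_le: "k \<in> set_decode n \<Longrightarrow> lam n \<le> k"
  by (simp add: lam_eq_Min)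

lemma lam_le_mu: "0 < n \<Longrightarrow> lam n \<le> mu n"
  by (intro le_mu lam_mem)

lemma less_exp_mu: "n < 2 ^ Suc (mu n)"
proof -
  have "take_bit (Suc (mu n)) n = n"
    by (rule bit_eqI) (use le_mu in \<open>auto simp: bit_take_bit_iff less_Suc_eq_le set_decode_eq_bits\<close>)
  then show ?thesis using take_bit_nat_less_exp[of "Suc (mu n)" n] by simp
qed

lemma set_decode_add:
  assumes "set_decode x \<inter> set_decode y = {}"
  shows "set_decode (x + y) = set_decode x \<union> set_decode y"
proof -
  have "set_encode (set_decode x \<union> set_decode y) =
      set_encode (set_decode x) + set_encode (set_decode y)"
    unfolding set_encode_def by (rule sum.union_disjoint) (use assms in auto)
  then show ?thesis
    by (metis finite_Un finite_set_decode set_decode_inverse set_encode_inverse)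
qed

lemma ll_iff: "0 < y \<Longrightarrow> x \<lless> y \<longleftrightarrow> mu x < lam y"
proof -
  assume "0 < y"
  have "x < y" if "mu x < lam y"
  proof -
    have "x < 2 ^ Suc (mu x)" by (rule less_exp_mu)
    also have "\<dots> \<le> 2 ^ lam y" using that by (intro power_increasing) auto
    also have "\<dots> \<le> y" using \<open>0 < y\<close> by (intro exp_le_if_mem_set_decode lam_mem)
    finally show ?thesis .
  qed
  then show ?thesis unfolding ll_def by blast
qed

lemma set_decode_add_apart:
  assumes "mu x < lam y"
  shows "set_decode (x + y) = set_decode x \<union> set_decode y"
  by (rule set_decode_add) (use assms in \<open>fastforce dest: le_mu lam_le\<close>)

lemma mu_add_apart:
  assumes "0 < y" "mu x < lam y"
  shows "mu (x + y) = mu y"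
proof (cases "x = 0")
  case False
  then have "mu (x + y) = max (mu x) (mu y)"
    using assms
    by (simp add: mu_eq_Max[of "_ + _"] set_decode_add_apart Max_Un) (simp add: mu_eq_Max)
  then show ?thesis using assms lam_le_mu[of y] by simp
qed simp

lemma lam_add_apart:
  assumes "0 < x" "mu x < lam y"
  shows "lam (x + y) = lam x"
proof (cases "y = 0")
  case False
  then have "lam (x + y) = min (lam x) (lam y)"
    using assms
    by (simp add: lam_eq_Min[of "_ + _"] set_decode_add_apart Min_Un) (simp add: lam_eq_Min)
  then show ?thesis using assms lam_le_mu[of x] by simp
qed simp

lemma computable_mu [computable_intros]:
  assumes "computable a"
  shows "computable (\<lambda>v. mu (a v))"
proof (rule computable_subst1[OF _ assms],
    rule computable_if_decidable_graph[where b = "\<lambda>v. v 0 + mu 0"])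
  define z where "z = mu 0"
  have "k = mu n \<longleftrightarrow> n = 0 \<and> k = z \<or>
      0 < n \<and> k \<in> set_decode n \<and> (\<forall>i<n. i \<in> set_decode n \<longrightarrow> i \<le> k)" for k n
    by (cases "n = 0") (auto simp: z_def mu_mem le_mu less_if_mem_set_decode intro: antisym)
  then show "decidable (\<lambda>v. v 0 = mu (v (Suc 0)))"
    by (simp only:) (intro computable_intros)
  show "mu (v 0) \<le> v 0 + mu 0" for v
    using less_if_mem_set_decode[OF mu_mem, of "v 0"] by (cases "v 0 = 0") auto
qed (intro computable_intros)

subsection \<open>Marked pairs of consecutive bits\<close>

definition consecutive :: "'a::linorder set \<Rightarrow> 'a \<Rightarrow> 'a \<Rightarrow> bool" where
  "consecutive B i j \<longleftrightarrow> i \<in> B \<and> j \<in> B \<and> i < j \<and> (\<forall>k<j. i < k \<longrightarrow> k \<notin> B)"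

definition weight :: "('a \<Rightarrow> 'a \<Rightarrow> bool) \<Rightarrow> 'a::linorder set \<Rightarrow> nat" where
  "weight M B = card {(i, j). consecutive B i j \<and> M i j}"

lemma consecutive_Un:
  assumes "finite X" "X \<noteq> {}" "finite Y" "Y \<noteq> {}" "Max X < Min Y"
  shows "consecutive (X \<union> Y) i j \<longleftrightarrow>
    consecutive X i j \<or> consecutive Y i j \<or> i = Max X \<and> j = Min Y"
proof -
  have Max: "Max X \<in> X" "\<And>k. k \<in> X \<Longrightarrow> k \<le> Max X"
    and Min: "Min Y \<in> Y" "\<And>k. k \<in> Y \<Longrightarrow> Min Y \<le> k"
    using assms by auto
  have below: "x < y" if "x \<in> X" "y \<in> Y" for x y
    using Max(2)[OF that(1)] Min(2)[OF that(2)] assms(5) by simp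
  consider (inside_X) "i \<in> X" "j \<in> X" | (inside_Y) "i \<in> Y" "j \<in> Y" | (across) "i \<in> X" "j \<in> Y"
    | (neither) "j < i \<or> i \<notin> X \<union> Y \<or> j \<notin> X \<union> Y"
    using below by blast
  then show ?thesis
  proof cases
    case across
    have "consecutive (X \<union> Y) i j \<longleftrightarrow> i = Max X \<and> j = Min Y"
    proof
      assume "consecutive (X \<union> Y) i j"
      then have gap: "\<not> (i < k \<and> k < j)" if "k \<in> X \<union> Y" for k
        using that by (auto simp: consecutive_def)
      show "i = Max X \<and> j = Min Y"
        using gap[of "Max X"] gap[of "Min Y"] Max Min across below by (metis UnCI order_le_less)
    next
      assume "i = Max X \<and> j = Min Y"
      then show "consecutive (X \<union> Y) i j"
        using across assms(5) Max(2) Min(2) by (auto simp: consecutive_def simp flip: not_less)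
    qed
    then show ?thesis using across below by (auto simp: consecutive_def)
  qed (use below Max(1) Min(1) in \<open>auto simp: consecutive_def dest: below less_asym\<close>)
qed

lemma finite_consecutive: "finite B \<Longrightarrow> finite {(i, j). consecutive B i j \<and> P i j}"
  by (rule finite_subset[of _ "B \<times> B"]) (auto simp: consecutive_def)

lemma weight_Un:
  assumes "finite X" "X \<noteq> {}" "finite Y" "Y \<noteq> {}" "Max X < Min Y"
  shows "weight M (X \<union> Y) = weight M X + of_bool (M (Max X) (Min Y)) + weight M Y"
proof -
  let ?pairs = "\<lambda>B. {(i, j). consecutive B i j \<and> M i j}"
  let ?joint = "{(i, j). i = Max X \<and> j = Min Y \<and> M i j}"
  have "?joint = (if M (Max X) (Min Y) then {(Max X, Min Y)} else {})" by auto
  then have joint: "finite ?joint" "card ?joint = of_bool (M (Max X) (Min Y))" by auto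
  have "X \<inter> Y = {}"
    using assms(5) Max_ge[OF assms(1)] Min_le[OF assms(3)] by fastforce
  then have separate: "Max X \<in> X" "Min Y \<in> Y" "X \<inter> Y = {}" using assms by auto
  have "?pairs (X \<union> Y) = ?pairs X \<union> ?joint \<union> ?pairs Y" using consecutive_Un[OF assms] by auto
  moreover have "?pairs X \<inter> ?joint = {}" "(?pairs X \<union> ?joint) \<inter> ?pairs Y = {}"
    using separate by (auto simp: consecutive_def)
  ultimately show ?thesis
    unfolding weight_def using joint assms(1,3) by (simp add: card_Un_disjoint finite_consecutive)
qed

lemma weight_cong:
  assumes "B = B'" "\<And>i j. consecutive B' i j \<Longrightarrow> M i j = M' i j"
  shows "weight M B = weight M' B'"
  unfolding weight_def assms(1) using assms(2) by (intro arg_cong[of _ _ card]) auto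

lemma weight_eq_sum:
  assumes "B \<subseteq> {..<n::nat}"
  shows "weight M B = (\<Sum>i<n. \<Sum>j<n. of_bool (consecutive B i j \<and> M i j))"
proof -
  have pairs: "{(i, j). consecutive B i j \<and> M i j} =
      {..<n} \<times> {..<n} \<inter> {p. case p of (i, j) \<Rightarrow> consecutive B i j \<and> M i j}"
    using assms by (auto simp: consecutive_def)
  show ?thesis
    unfolding weight_def sum.cartesian_product
    by (subst pairs) (simp add: split_def sum_of_bool_eq)
qed

lemma decidable_consecutive [computable_intros]:
  assumes "computable a" "computable i" "computable j"
  shows "decidable (\<lambda>v. consecutive (set_decode (a v)) (i v) (j v))"
  by (rule decidable_subst3[where P = "\<lambda>a. consecutive (set_decode a)", OF _ assms])
    (unfold consecutive_def, intro computable_intros)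

lemma computable_weight [computable_intros]:
  assumes "decidable (\<lambda>v. M (v (Suc 0)) (v 0) (\<lambda>i. v (Suc (Suc i))))" "computable a"
  shows "computable (\<lambda>v. weight (\<lambda>i j. M i j v) (set_decode (a v)))"
proof -
  have "weight (\<lambda>i j. M i j v) (set_decode n) =
      (\<Sum>i<n. \<Sum>j<n. of_bool (consecutive (set_decode n) i j \<and> M i j v))" for n v
    by (intro weight_eq_sum) (auto dest: less_if_mem_set_decode)
  then show ?thesis
    using assms computable_shift[OF assms(2)] computable_shift[OF computable_shift[OF assms(2)]]
    by (simp only:) (intro computable_intros)
qed

declare conj_cong [fundef_cong]

text \<open>
  \<open>S j x\<close> says that \<open>x\<close> is to be served at \<open>j\<close>.  Whether \<open>(\<mu> x, j)\<close> is marked depends on the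
  marked pairs inside \<open>x\<close>, all of which have second component below \<open>j\<close>.
\<close>

function marked :: "(nat \<Rightarrow> nat \<Rightarrow> bool) \<Rightarrow> nat \<Rightarrow> nat \<Rightarrow> bool" where
  "marked S i j \<longleftrightarrow> i < j \<and> (\<exists>x>0. mu x = i \<and> S j x \<and>
     even (weight (\<lambda>i' j'. j' < j \<and> marked S i' j') (set_decode x)))"
  by auto
termination by (relation "measure (\<lambda>(S, i, j). j)") auto

declare marked.simps [simp del]

lemma marked_iff:
  "marked S i j \<longleftrightarrow>
     i < j \<and> (\<exists>x>0. mu x = i \<and> S j x \<and> even (weight (marked S) (set_decode x)))"
proof -
  have "weight (\<lambda>i' j'. j' < j \<and> marked S i' j') (set_decode x) = weight (marked S) (set_decode x)"
    if "mu x < j" for x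
    by (rule weight_cong) (use that in \<open>auto simp: consecutive_def dest: le_mu\<close>)
  then show ?thesis by (subst marked.simps) auto
qed

lemma odd_weight_add_iff:
  assumes "0 < x" "0 < y" "mu x < lam y" "S (lam y) x"
    and unique: "\<And>x'. 0 < x' \<Longrightarrow> mu x' = mu x \<Longrightarrow> S (lam y) x' \<Longrightarrow> x' = x"
  shows "odd (weight (marked S) (set_decode (x + y))) \<longleftrightarrow> even (weight (marked S) (set_decode y))"
proof -
  let ?w = "\<lambda>n. weight (marked S) (set_decode n)"
  have "marked S (mu x) (lam y) \<longleftrightarrow> even (?w x)"
    unfolding marked_iff[of S "mu x"] using assms(1,3,4) unique by blast
  moreover have "?w (x + y) = ?w x + of_bool (marked S (mu x) (lam y)) + ?w y"
    using assms(1-3) unfolding set_decode_add_apart[OF assms(3)]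
    by (subst weight_Un) (auto simp: mu_eq_Max lam_eq_Min)
  ultimately show ?thesis by auto
qed

lemma prod_encode_less: "i + j < i' + j' \<Longrightarrow> prod_encode (i, j) < prod_encode (i', j')"
proof -
  assume "i + j < i' + j'"
  moreover have "triangle m \<le> triangle n" if "m \<le> n" for m n
    using that by (induction n rule: dec_induct) auto
  ultimately have "triangle (Suc (i + j)) \<le> triangle (i' + j')" by (metis Suc_leI)
  then show ?thesis by (simp add: prod_encode_def)
qed

lemma weight_less_prod_encode:
  assumes "mu x = i" "i < j"
  shows "weight (\<lambda>i' j'. prod_encode (i', j') < prod_encode (i, j) \<and> M i' j') (set_decode x)
    = weight M (set_decode x)"
proof (rule weight_cong)
  fix i' j' assume "consecutive (set_decode x) i' j'"
  then have "i' < j'" "j' \<le> i" using assms(1) le_mu by (auto simp: consecutive_def)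
  then have "prod_encode (i', j') < prod_encode (i, j)"
    using assms(2) by (intro prod_encode_less) auto
  then show "prod_encode (i', j') < prod_encode (i, j) \<and> M i' j' \<longleftrightarrow> M i' j'" by simp
qed simp

lemma decidable_marked:
  assumes S: "decidable (\<lambda>v. S (v 0) (v 1) (v 2))"
    and "computable t" "computable i" "computable j"
  shows "decidable (\<lambda>v. marked (S (t v)) (i v) (j v))"
proof (rule decidable_subst3[where P = "\<lambda>t. marked (S t)", OF _ assms(2-)])
  define Q where "Q k v \<longleftrightarrow> marked (S (v 0)) (pfst k) (psnd k)"
    for k and v :: "nat \<Rightarrow> nat"
  define R where "R H k v \<longleftrightarrow> pfst k < psnd k \<and>
      (\<exists>x<2 ^ Suc (pfst k). 0 < x \<and> mu x = pfst k \<and>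
        S (v 0) (psnd k) x \<and>
        even (weight (\<lambda>i j. prod_encode (i, j) \<in> set_decode H) (set_decode x)))"
    for H k and v :: "nat \<Rightarrow> nat"
  have step: "decidable (\<lambda>v. R (v 0) (v (Suc 0)) (\<lambda>i. v (Suc (Suc i))))"
    unfolding R_def by (intro decidable_subst3[where P = S, OF S] computable_intros)
  have rec: "Q k v \<longleftrightarrow> R (set_encode {k'. k' < k \<and> Q k' v}) k v" for k v
  proof -
    obtain i j where k: "k = prod_encode (i, j)"
      using surj_prod_encode by (metis surj_def surj_pair)
    have bound: "x < 2 ^ Suc i" if "mu x = i" for x using less_exp_mu[of x] that by simp
    have "R (set_encode {k'. k' < k \<and> Q k' v}) k v \<longleftrightarrow>
        i < j \<and> (\<exists>x<2 ^ Suc i. 0 < x \<and> mu x = i \<and> S (v 0) j x \<and>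
          even (weight (marked (S (v 0))) (set_decode x)))"
      by (simp add: R_def Q_def k weight_less_prod_encode cong: conj_cong)
    then show ?thesis
      using bound by (auto simp: Q_def k marked_iff[of _ i])
  qed
  have "computable (\<lambda>v. prod_encode (v 1, v 2))" by (intro computable_intros)
  from decidable_course_of_values[OF step rec this]
  show "decidable (\<lambda>v. marked (S (v 0)) (v 1) (v 2))" by (simp add: Q_def)
qed

definition color :: "(nat \<Rightarrow> nat \<Rightarrow> nat \<Rightarrow> bool) \<Rightarrow> nat \<Rightarrow> nat" where
  "color S n = of_bool (odd (weight (marked (S (mu n))) (set_decode n)))"

lemma recursive_color:
  assumes "decidable (\<lambda>v. S (v 0) (v 1) (v 2))"
  shows "recursive_fun (color S)"
  by (rule recursive_funI)
    (unfold color_def, intro decidable_marked[where S = S, OF assms] computable_intros)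

lemma color_add_neq:
  assumes "0 < x" "0 < y" "mu x < lam y" "S (mu y) (lam y) x"
    and "\<And>x'. 0 < x' \<Longrightarrow> mu x' = mu x \<Longrightarrow> S (mu y) (lam y) x' \<Longrightarrow> x' = x"
  shows "color S (x + y) \<noteq> color S y"
  using odd_weight_add_iff[of x y "S (mu y)"] assms by (simp add: color_def mu_add_apart)

subsection \<open>Serving every set\<close>

definition initial :: "nat \<Rightarrow> nat set \<Rightarrow> nat set" where
  "initial N B = {x \<in> B. card (B \<inter> {..<x}) < N}"

lemma
  shows finite_initial: "finite (initial N B)"
    and card_initial_le: "card (initial N B) \<le> N"
proof -
  let ?f = "\<lambda>x. card (B \<inter> {..<x})"
  have "?f x < ?f x'" if "x < x'" "x \<in> B" for x x'
    by (rule psubset_card_mono) (use that in auto)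
  then have inj: "inj_on ?f (initial N B)"
    by (intro linorder_inj_onI) (auto simp: initial_def less_imp_neq)
  have sub: "?f ` initial N B \<subseteq> {..<N}" by (auto simp: initial_def)
  show "finite (initial N B)" "card (initial N B) \<le> N"
    using inj_on_finite[OF inj sub] card_inj_on_le[OF inj sub] by simp_all
qed

lemma initial_card_Int_lessThan:
  "initial (card (B \<inter> {..<m})) B = B \<inter> {..<m}"
proof -
  have "card (B \<inter> {..<x}) < card (B \<inter> {..<m}) \<longleftrightarrow> x < m" if "x \<in> B" for x
  proof
    assume "x < m"
    then show "card (B \<inter> {..<x}) < card (B \<inter> {..<m})"
      using that by (intro psubset_card_mono) auto
  next
    assume "card (B \<inter> {..<x}) < card (B \<inter> {..<m})"
    then have "\<not> B \<inter> {..<m} \<subseteq> B \<inter> {..<x}" by (meson card_mono finite_Int finite_lessThan not_le)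
    then show "x < m" by (auto simp: not_le)
  qed
  then show ?thesis by (auto simp: initial_def)
qed

lemma card_Int_lessThan_enumerate:
  assumes "infinite (A :: nat set)"
  shows "card (A \<inter> {..<enumerate A n}) = n"
proof -
  have "A \<inter> {..<enumerate A n} = enumerate A ` {..<n}"
    using assms enumerate_Ex[of A] by (fastforce simp: enumerate_in_set)
  then show ?thesis
    using inj_enumerate[OF assms] by (simp add: card_image inj_on_subset)
qed

text \<open>\<open>K e\<close> consists of the elements that the \<open>e\<close>-th set wants to be served.\<close>

definition served :: "(nat \<Rightarrow> nat set) \<Rightarrow> nat \<Rightarrow> nat \<Rightarrow> bool" where
  "served K j x \<longleftrightarrow> (\<exists>e<j. x \<in> K e \<and> (\<forall>e'<e. mu x \<notin> mu ` K e'))"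

lemma ex_not_mem_smaller_images:
  fixes K :: "nat \<Rightarrow> 'a set"
  assumes K: "\<And>k. k < e \<Longrightarrow> finite (K k) \<and> card (K k) \<le> 2 ^ k"
    and "card (K e) = 2 ^ e" "inj_on f (K e)"
  shows "\<exists>x\<in>K e. \<forall>k<e. f x \<notin> f ` K k"
proof -
  let ?T = "\<Union>k<e. f ` K k"
  have "card ?T \<le> (\<Sum>k<e. card (f ` K k))" by (rule card_UN_le) simp
  also have "\<dots> \<le> (\<Sum>k<e. 2 ^ k)"
    using K card_image_le order_trans by (intro sum_mono) blast
  also have "\<dots> < 2 ^ e" by (induction e) auto
  also have "\<dots> = card (f ` K e)" using assms(2,3) by (simp add: card_image)
  finally have "\<not> f ` K e \<subseteq> ?T"
    using K card_mono[of ?T "f ` K e"] by (auto simp: not_le)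
  then show ?thesis by blast
qed

lemma served_unique:
  assumes "x \<in> K e" "\<forall>k<e. mu x \<notin> mu ` K k" "inj_on mu (K e)" "served K j y" "mu y = mu x"
  shows "y = x"
proof -
  from assms(4) obtain k where k: "y \<in> K k" "\<And>k'. k' < k \<Longrightarrow> mu y \<notin> mu ` K k'"
    unfolding served_def by blast
  have "k = e" using assms(1,2,5) k by (metis imageI linorder_neqE_nat)
  then show ?thesis using assms(1,3,5) k(1) by (simp add: inj_on_def)
qed

definition wanted :: "(nat \<Rightarrow> nat \<Rightarrow> nat \<Rightarrow> nat \<Rightarrow> bool) \<Rightarrow> nat \<Rightarrow> nat \<Rightarrow> nat \<Rightarrow> nat set" where
  "wanted G t j e = initial (2 ^ e) {x. 0 < x \<and> G e x j t}"

definition served_at :: "(nat \<Rightarrow> nat \<Rightarrow> nat \<Rightarrow> nat \<Rightarrow> bool) \<Rightarrow> nat \<Rightarrow> nat \<Rightarrow> nat \<Rightarrow> bool" where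
  "served_at G t j = served (wanted G t j) j"

lemma decidable_wanted:
  assumes G: "recursive_rel4 G" and "computable t" "computable j" "computable e" "computable x"
  shows "decidable (\<lambda>v. x v \<in> wanted G (t v) (j v) (e v))"
proof (rule decidable_subst4[where P = "\<lambda>t j e x. x \<in> wanted G t j e", OF _ assms(2-)])
  have "x \<in> wanted G t j e \<longleftrightarrow> (0 < x \<and> G e x j t) \<and>
      (\<Sum>y<x. of_bool (0 < y \<and> G e y j t)) < (2::nat) ^ e" for t j e x
    by (simp add: wanted_def initial_def sum_of_bool_eq Int_commute)
  then show "decidable (\<lambda>v. v 3 \<in> wanted G (v 0) (v 1) (v 2))"
    by (simp only:) (intro decidable_recursive_rel4[OF G] computable_intros)
qed

lemma decidable_served_at:
  assumes "recursive_rel4 G"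
  shows "decidable (\<lambda>v. served_at G (v 0) (v 1) (v 2))"
proof -
  have "mu x \<notin> mu ` wanted G t j e \<longleftrightarrow>
      (\<forall>y<2 ^ Suc (mu x). y \<in> wanted G t j e \<longrightarrow> mu y \<noteq> mu x)" for x t j e
    using less_exp_mu by (metis (no_types, lifting) image_iff)
  then show ?thesis
    unfolding served_at_def served_def
    by (simp only:) (intro decidable_wanted[OF assms] computable_intros)
qed

lemma wanted_eq:
  assumes "A \<subseteq> {0<..}" "card (A \<inter> {..<m}) = 2 ^ e" "\<And>x. x < m \<Longrightarrow> G e x j t \<longleftrightarrow> x \<in> A"
  shows "wanted G t j e = A \<inter> {..<m}"
proof -
  have "{x. 0 < x \<and> G e x j t} \<inter> {..<m} = A \<inter> {..<m}" using assms(1,3) by auto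
  then show ?thesis
    using initial_card_Int_lessThan[of _ m] assms(2) unfolding wanted_def by metis
qed

lemma ex_served_at:
  assumes "card (wanted G t j e) = 2 ^ e" "inj_on mu (wanted G t j e)" "e < j"
  obtains x where "x \<in> wanted G t j e" "served_at G t j x"
    "\<And>y. served_at G t j y \<Longrightarrow> mu y = mu x \<Longrightarrow> y = x"
proof -
  obtain x where x: "x \<in> wanted G t j e" "\<forall>k<e. mu x \<notin> mu ` wanted G t j k"
    using ex_not_mem_smaller_images[of e "wanted G t j" mu] assms(1,2)
      finite_initial card_initial_le
    unfolding wanted_def by blast
  with assms(3) have "served_at G t j x" unfolding served_at_def served_def by blast
  with x(1) show thesis
    by (rule that) (use served_unique[OF x assms(2)] in \<open>simp add: served_at_def\<close>)
qed

definition double_limit :: "(nat \<Rightarrow> nat \<Rightarrow> nat \<Rightarrow> bool) \<Rightarrow> nat set \<Rightarrow> bool" where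
  "double_limit g A \<longleftrightarrow>
     (\<forall>x. \<forall>\<^sub>F j in sequentially. \<forall>\<^sub>F t in sequentially. g x j t \<longleftrightarrow> x \<in> A)"

lemma eventually_wanted:
  assumes A: "A \<subseteq> {0<..}" "infinite A" "double_limit (G e) A"
  obtains F where "F \<subseteq> A" "finite F" "card F = 2 ^ e"
    "\<forall>\<^sub>F j in sequentially. \<forall>\<^sub>F t in sequentially. wanted G t j e = F"
proof -
  obtain m where m: "card (A \<inter> {..<m}) = 2 ^ e"
    using card_Int_lessThan_enumerate[OF A(2)] by blast
  have "\<forall>\<^sub>F j in sequentially. \<forall>x\<in>{..<m}. \<forall>\<^sub>F t in sequentially. G e x j t \<longleftrightarrow> x \<in> A"
    using A(3) unfolding double_limit_def by (intro eventually_ball_finite) auto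
  then have "\<forall>\<^sub>F j in sequentially. \<forall>\<^sub>F t in sequentially. wanted G t j e = A \<inter> {..<m}"
  proof eventually_elim
    case (elim j)
    then have "\<forall>\<^sub>F t in sequentially. \<forall>x\<in>{..<m}. G e x j t \<longleftrightarrow> x \<in> A"
      by (intro eventually_ball_finite) auto
    then show ?case by eventually_elim (rule wanted_eq[OF A(1) m], simp)
  qed
  with m show thesis by (intro that[of "A \<inter> {..<m}"]) auto
qed

lemma color_served_at_neq:
  assumes A: "A \<subseteq> {0<..}" "infinite A" "inj_on mu A" "double_limit (G e) A"
    and lam: "\<And>l. \<exists>w\<in>A. l \<le> lam w"
  shows "\<exists>x\<in>A. \<exists>w1\<in>A. \<exists>w2\<in>A. x \<lless> w1 \<and> w1 \<lless> w2 \<and>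
    color (served_at G) (w1 + w2) \<noteq> color (served_at G) (x + w1 + w2)"
proof -
  obtain F where F: "F \<subseteq> A" "finite F" "card F = 2 ^ e"
    and wanted: "\<forall>\<^sub>F j in sequentially. \<forall>\<^sub>F t in sequentially. wanted G t j e = F"
    using eventually_wanted[of A G e, OF A(1,2,4)] by blast
  have "\<forall>\<^sub>F j in sequentially. \<forall>x\<in>F. mu x < j"
    using F(2) eventually_gt_at_top by (intro eventually_ball_finite) auto
  from eventually_conj[OF wanted eventually_conj[OF this eventually_gt_at_top[of e]]]
  obtain w1 where w1: "w1 \<in> A" "\<forall>\<^sub>F t in sequentially. wanted G t (lam w1) e = F"
    "\<forall>x\<in>F. mu x < lam w1" "e < lam w1"
    using lam unfolding eventually_sequentially by meson
  from w1(2) obtain t0 where t0: "\<And>t. t0 \<le> t \<Longrightarrow> wanted G t (lam w1) e = F"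
    unfolding eventually_sequentially by blast
  obtain w2 where w2: "w2 \<in> A" "max t0 (Suc (mu w1)) \<le> lam w2" using lam by blast
  have pos: "0 < w1" "0 < w2" using w1(1) w2(1) A(1) by auto
  have "wanted G (mu w2) (lam w1) e = F" using w2(2) lam_le_mu[OF pos(2)] by (intro t0) simp
  then obtain x where x: "x \<in> F" "served_at G (mu w2) (lam w1) x"
    "\<And>y. served_at G (mu w2) (lam w1) y \<Longrightarrow> mu y = mu x \<Longrightarrow> y = x"
    using ex_served_at[of G "mu w2" "lam w1" e] F inj_on_subset[OF A(3)] w1(4) by metis
  have apart: "0 < x" "mu x < lam w1" "mu w1 < lam w2" using x(1) F(1) A(1) w1(3) w2(2) by auto
  then have "color (served_at G) (x + (w1 + w2)) \<noteq> color (served_at G) (w1 + w2)"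
    using pos x(2,3) by (intro color_add_neq) (simp_all add: mu_add_apart lam_add_apart)
  moreover have "x \<lless> w1" "w1 \<lless> w2" using apart pos by (simp_all add: ll_iff)
  ultimately show ?thesis using x(1) F(1) w1(1) w2(1) by (metis add.assoc subsetD)
qed

subsection \<open>A universal evaluator by stages\<close>

abbreviation code_Cons :: "nat \<Rightarrow> nat \<Rightarrow> nat" where
  "code_Cons x l \<equiv> Suc (prod_encode (x, l))"

primrec code_drop :: "nat \<Rightarrow> nat \<Rightarrow> nat" where
  "code_drop 0 l = l"
| "code_drop (Suc i) l = psnd (code_drop i l - 1)"

definition code_nth :: "nat \<Rightarrow> nat \<Rightarrow> nat" where
  "code_nth l i = pfst (code_drop i l - 1)"

definition code_length :: "nat \<Rightarrow> nat" where
  "code_length l = length (list_decode l)"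

lemma prod_decode_0 [simp]: "prod_decode 0 = (0, 0)"
  using prod_encode_inverse[of "(0, 0)"] by (simp add: prod_encode_def)

lemma code_drop_list_encode: "code_drop i (list_encode xs) = list_encode (drop i xs)"
proof (induction i)
  case (Suc i)
  have "psnd (list_encode ys - 1) = list_encode (tl ys)" for ys
    by (cases ys) auto
  then show ?case using Suc by (simp add: drop_Suc tl_drop)
qed simp

lemma code_nth_list_encode [simp]: "i < length xs \<Longrightarrow> code_nth (list_encode xs) i = xs ! i"
  by (simp add: code_nth_def code_drop_list_encode flip: Cons_nth_drop_Suc)

lemma code_length_list_encode [simp]: "code_length (list_encode xs) = length xs"
  by (simp add: code_length_def)

lemma ex_less_list_encode: "(\<exists>l<s. P l) \<longleftrightarrow> (\<exists>xs. list_encode xs < s \<and> P (list_encode xs))"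
  by (metis list_decode_inverse)

lemma list_encode_eq_0_iff [simp]: "list_encode xs = 0 \<longleftrightarrow> xs = []"
  by (cases xs) auto

lemma length_le_list_encode: "length xs \<le> list_encode xs"
proof (induction xs)
  case (Cons x xs)
  then show ?case using le_prod_encode_2[of "list_encode xs" x] by simp
qed simp

lemma computable_code_drop [computable_intros]:
  assumes "computable i" "computable l"
  shows "computable (\<lambda>v. code_drop (i v) (l v))"
proof (rule computable_subst2[OF _ assms])
  have "code_drop i l = rec_nat l (\<lambda>_ y. psnd (y - 1)) i" for i l
    by (induction i) auto
  then show "computable (\<lambda>v. code_drop (v 0) (v 1))"
    by (simp only:) (intro computable_rec_nat computable_intros)
qed

lemma computable_code_nth [computable_intros]:
  "computable l \<Longrightarrow> computable i \<Longrightarrow> computable (\<lambda>v. code_nth (l v) (i v))"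
  unfolding code_nth_def by (intro computable_intros)

lemma computable_code_length [computable_intros]:
  assumes "computable l"
  shows "computable (\<lambda>v. code_length (l v))"
proof (rule computable_subst1[OF _ assms], rule computable_if_decidable_graph[where b = "\<lambda>v. v 0"])
  have "n = length xs \<longleftrightarrow> drop n xs = [] \<and> (\<forall>i<n. drop i xs \<noteq> [])" for n and xs :: "nat list"
    by (auto simp: not_le intro: antisym leI)
  then have "n = code_length l \<longleftrightarrow> code_drop n l = 0 \<and> (\<forall>i<n. code_drop i l \<noteq> 0)" for n l
    using code_drop_list_encode[of _ "list_decode l"] by (simp add: code_length_def)
  then show "decidable (\<lambda>v. v 0 = code_length (v (Suc 0)))"
    by (simp only:) (intro computable_intros)
  show "code_length (v 0) \<le> v 0" for v
    using length_le_list_encode[of "list_decode (v 0)"] by (simp add: code_length_def)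
qed (rule computable_var)

fun recf_code :: "recf \<Rightarrow> nat" where
  "recf_code Zero = prod_encode (0, 0)"
| "recf_code Succ = prod_encode (1, 0)"
| "recf_code (Proj i) = prod_encode (2, i)"
| "recf_code (Comp f gs) =
     prod_encode (3, prod_encode (recf_code f, list_encode (map recf_code gs)))"
| "recf_code (Prec f g) = prod_encode (4, prod_encode (recf_code f, recf_code g))"
| "recf_code (Mini f) = prod_encode (5, recf_code f)"

abbreviation eval_code :: "nat \<Rightarrow> nat \<Rightarrow> nat \<Rightarrow> nat" where
  "eval_code p l z \<equiv> prod_encode (p, prod_encode (l, z))"

text \<open>
  The evaluation rules, read on codes: \<open>E\<close> encodes the set of premises available at stage \<open>s\<close>,
  and \<open>s\<close> bounds the search for intermediate values.
\<close>

definition eval_step :: "nat \<Rightarrow> nat \<Rightarrow> nat \<Rightarrow> nat \<Rightarrow> nat \<Rightarrow> bool" where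
  "eval_step s E p l z \<longleftrightarrow>
     (let tag = pfst p; a = psnd p; f = pfst a; g = psnd a
      in tag = 0 \<and> z = 0 \<or>
      tag = 1 \<and> (\<exists>x<l. \<exists>k<l. l = code_Cons x k \<and> z = Suc x) \<or>
      tag = 2 \<and> a < code_length l \<and> z = code_nth l a \<or>
      tag = 3 \<and> (\<exists>ys<s. code_length ys = code_length g \<and>
        (\<forall>i<code_length g. eval_code (code_nth g i) l (code_nth ys i) \<in> set_decode E) \<and>
        eval_code f ys z \<in> set_decode E) \<or>
      tag = 4 \<and> (\<exists>k<l. l = code_Cons 0 k \<and> eval_code f k z \<in> set_decode E) \<or>
      tag = 4 \<and> (\<exists>n<l. \<exists>k<l. l = code_Cons (Suc n) k \<and> (\<exists>y<s.
        eval_code p (code_Cons n k) y \<in> set_decode E \<and>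
        eval_code g (code_Cons y (code_Cons n k)) z \<in> set_decode E)) \<or>
      tag = 5 \<and> eval_code a (code_Cons z l) 0 \<in> set_decode E \<and>
        (\<forall>m<z. \<exists>y<s. 0 < y \<and> eval_code a (code_Cons m l) y \<in> set_decode E))"

definition next_stage :: "nat \<Rightarrow> nat \<Rightarrow> nat" where
  "next_stage s E =
     set_encode {k. k < s \<and> eval_step s E (pfst k) (pfst (psnd k)) (psnd (psnd k))}"

primrec stage :: "nat \<Rightarrow> nat" where
  "stage 0 = 0"
| "stage (Suc s) = next_stage s (stage s)"

definition evaluated :: "nat \<Rightarrow> recf \<Rightarrow> nat list \<Rightarrow> nat \<Rightarrow> bool" where
  "evaluated s t xs z \<longleftrightarrow> eval_code (recf_code t) (list_encode xs) z \<in> set_decode (stage s)"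

lemma computable_stage [computable_intros]:
  assumes "computable a"
  shows "computable (\<lambda>v. stage (a v))"
proof (rule computable_subst1[OF _ assms])
  have "stage k = rec_nat 0 next_stage k" for k by (induction k) auto
  then show "computable (\<lambda>v. stage (v 0))"
    by (simp only:)
      (unfold next_stage_def eval_step_def Let_def, intro computable_rec_nat computable_intros)
qed

lemma evaluated_Suc_iff:
  "evaluated (Suc s) t xs z \<longleftrightarrow> eval_code (recf_code t) (list_encode xs) z < s \<and>
     eval_step s (stage s) (recf_code t) (list_encode xs) z"
  by (simp add: evaluated_def next_stage_def)

lemma evaluated_less: "evaluated s t xs z \<Longrightarrow> z < s"
proof (cases s)
  case (Suc s')
  assume "evaluated s t xs z"
  then have "eval_code (recf_code t) (list_encode xs) z < s'" by (simp add: Suc evaluated_Suc_iff)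
  moreover have "z \<le> eval_code (recf_code t) (list_encode xs) z"
    by (meson le_prod_encode_2 le_trans)
  ultimately show ?thesis using Suc by simp
qed (simp add: evaluated_def)

lemma less_code_Cons: "x < code_Cons x l" "l < code_Cons x l"
  by (simp_all add: less_Suc_eq_le le_prod_encode_1 le_prod_encode_2)

lemma eval_step_Zero: "eval_step s (stage s) (recf_code Zero) l z \<longleftrightarrow> z = 0"
  by (simp add: eval_step_def Let_def)

lemma eval_step_Succ:
  "eval_step s (stage s) (recf_code Succ) (list_encode xs) z \<longleftrightarrow>
     (\<exists>x ys. xs = x # ys \<and> z = Suc x)"
  by (cases xs) (auto simp: eval_step_def Let_def less_code_Cons)

lemma eval_step_Proj:
  "eval_step s (stage s) (recf_code (Proj i)) (list_encode xs) z \<longleftrightarrow>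
     i < length xs \<and> z = xs ! i"
  by (simp add: eval_step_def Let_def cong: conj_cong)

lemma eval_step_Comp:
  "eval_step s (stage s) (recf_code (Comp f gs)) (list_encode xs) z \<longleftrightarrow>
     (\<exists>ys. list_encode ys < s \<and> length ys = length gs \<and>
       (\<forall>i<length gs. evaluated s (gs ! i) xs (ys ! i)) \<and> evaluated s f ys z)"
  by (simp add: eval_step_def Let_def evaluated_def ex_less_list_encode cong: conj_cong)

lemma eval_step_Prec:
  "eval_step s (stage s) (recf_code (Prec f g)) (list_encode xs) z \<longleftrightarrow>
     (\<exists>ys. xs = 0 # ys \<and> evaluated s f ys z) \<or>
     (\<exists>n ys y. xs = Suc n # ys \<and> y < s \<and> evaluated s (Prec f g) (n # ys) y \<and>
       evaluated s g (y # n # ys) z)"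
  by (cases xs)
    (auto simp: eval_step_def Let_def evaluated_def less_code_Cons Suc_lessD[OF less_code_Cons(1)])

lemma eval_step_Mini:
  "eval_step s (stage s) (recf_code (Mini f)) (list_encode xs) n \<longleftrightarrow>
     evaluated s f (n # xs) 0 \<and> (\<forall>m<n. \<exists>y<s. 0 < y \<and> evaluated s f (m # xs) y)"
  by (simp add: eval_step_def Let_def evaluated_def)

lemma evaluated_sound: "evaluated s t xs z \<Longrightarrow> eval t xs z"
proof (induction s arbitrary: t xs z)
  case 0
  then show ?case by (simp add: evaluated_def)
next
  case (Suc s)
  then have step: "eval_step s (stage s) (recf_code t) (list_encode xs) z"
    by (simp add: evaluated_Suc_iff)
  show ?case
  proof (cases t)
    case Zero
    show ?thesis using step unfolding Zero eval_step_Zero by (auto intro: eval_Zero)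
  next
    case Succ
    show ?thesis using step unfolding Succ eval_step_Succ by (auto intro: eval_Succ)
  next
    case (Proj i)
    show ?thesis using step unfolding Proj eval_step_Proj by (auto intro: eval_Proj)
  next
    case (Comp f gs)
    show ?thesis using step Suc.IH unfolding Comp eval_step_Comp by (auto intro: eval_Comp)
  next
    case (Prec f g)
    show ?thesis
      using step Suc.IH unfolding Prec eval_step_Prec by (auto intro: eval_Prec0 eval_PrecS)
  next
    case (Mini f)
    show ?thesis
      using step Suc.IH unfolding Mini eval_step_Mini by (fastforce intro: eval_Mini)
  qed
qed

lemma eventually_evaluatedI:
  assumes "\<forall>\<^sub>F s in sequentially. eval_step s (stage s) (recf_code t) (list_encode xs) z"
  shows "\<forall>\<^sub>F s in sequentially. evaluated s t xs z"
proof -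
  have "\<forall>\<^sub>F s in sequentially. evaluated (Suc s) t xs z"
    using assms eventually_gt_at_top by eventually_elim (simp add: evaluated_Suc_iff)
  then show ?thesis by (subst (asm) eventually_sequentially_Suc)
qed

lemma evaluated_complete: "eval t xs z \<Longrightarrow> \<forall>\<^sub>F s in sequentially. evaluated s t xs z"
proof (induction rule: eval.induct)
  case (eval_Comp ys gs xs f z)
  then have "\<forall>\<^sub>F s in sequentially. \<forall>i\<in>{..<length gs}. evaluated s (gs ! i) xs (ys ! i)"
    by (intro eventually_ball_finite) auto
  with eval_Comp.IH(2) eventually_gt_at_top[of "list_encode ys"]
  have "\<forall>\<^sub>F s in sequentially. eval_step s (stage s) (recf_code (Comp f gs)) (list_encode xs) z"
    unfolding eval_step_Comp by eventually_elim (use eval_Comp.hyps(1) in auto)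
  then show ?case by (rule eventually_evaluatedI)
next
  case (eval_PrecS f g n xs y z)
  from eval_PrecS.IH
  have "\<forall>\<^sub>F s in sequentially.
      eval_step s (stage s) (recf_code (Prec f g)) (list_encode (Suc n # xs)) z"
    unfolding eval_step_Prec by eventually_elim (auto dest: evaluated_less)
  then show ?case by (rule eventually_evaluatedI)
next
  case (eval_Mini f n xs)
  have "\<forall>\<^sub>F s in sequentially. \<forall>m\<in>{..<n}. \<exists>y<s. 0 < y \<and> evaluated s f (m # xs) y"
  proof (intro eventually_ball_finite ballI)
    fix m assume "m \<in> {..<n}"
    then obtain y where "0 < y" "\<forall>\<^sub>F s in sequentially. evaluated s f (m # xs) y"
      using eval_Mini.IH(2) by auto
    then show "\<forall>\<^sub>F s in sequentially. \<exists>y<s. 0 < y \<and> evaluated s f (m # xs) y"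
      by (auto elim!: eventually_mono dest: evaluated_less)
  qed simp
  with eval_Mini.IH(1)
  have "\<forall>\<^sub>F s in sequentially. eval_step s (stage s) (recf_code (Mini f)) (list_encode xs) n"
    unfolding eval_step_Mini by eventually_elim auto
  then show ?case by (rule eventually_evaluatedI)
qed (rule eventually_evaluatedI;
    simp only: eval_step_Zero eval_step_Succ eval_step_Proj eval_step_Prec;
    force elim: eventually_mono)+

lemma eventually_evaluated_iff:
  "\<forall>\<^sub>F s in sequentially. (\<exists>d<s. evaluated s t (xs @ [d]) z) \<longleftrightarrow> (\<exists>d. eval t (xs @ [d]) z)"
proof (cases "\<exists>d. eval t (xs @ [d]) z")
  case True
  then obtain d where "\<forall>\<^sub>F s in sequentially. evaluated s t (xs @ [d]) z"
    using evaluated_complete by blast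
  with eventually_gt_at_top[of d] show ?thesis
    by eventually_elim (use True in blast)
qed (auto dest: evaluated_sound intro!: always_eventually)

lemma eval_deterministic: "eval t xs z \<Longrightarrow> eval t xs z' \<Longrightarrow> z = z'"
proof (induction arbitrary: z' rule: eval.induct)
  case (eval_Comp ys gs xs f z)
  from eval_Comp.prems obtain ys' where ys': "length ys' = length gs"
    "\<forall>i<length gs. eval (gs ! i) xs (ys' ! i)" "eval f ys' z'"
    by cases auto
  then have "ys = ys'" using eval_Comp.hyps(1) eval_Comp.IH(1) by (auto intro: nth_equalityI)
  then show ?case using eval_Comp.IH(2) ys'(3) by blast
next
  case (eval_PrecS f g n xs y z)
  from eval_PrecS.prems obtain y' where "eval (Prec f g) (n # xs) y'" "eval g (y' # n # xs) z'"
    by cases auto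
  then show ?case using eval_PrecS.IH by metis
next
  case (eval_Mini f n xs)
  from eval_Mini.prems have "eval f (z' # xs) 0" "\<forall>m<z'. \<exists>y. eval f (m # xs) y \<and> y \<noteq> 0"
    by (cases, simp)+
  then show ?case using eval_Mini.IH by (metis linorder_neqE_nat)
qed (erule eval.cases; auto)+

subsection \<open>The double limit lemma\<close>

text \<open>
  Used for complementary sentences \<open>\<exists>a. \<forall>b. S a b\<close> and \<open>\<exists>a. \<forall>b. T a b\<close>: a witness of the true one
  is never refuted, while all candidates up to it for the false one are refuted from some stage on.
\<close>

definition believes :: "(nat \<Rightarrow> nat \<Rightarrow> bool) \<Rightarrow> (nat \<Rightarrow> nat \<Rightarrow> bool) \<Rightarrow> nat \<Rightarrow> bool" where
  "believes S T j \<longleftrightarrow> (\<exists>a<j. (\<forall>b<j. S a b) \<and> (\<forall>a'<a. \<exists>b<j. \<not> T a' b))"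

lemma eventually_refuted:
  fixes n :: nat and S :: "nat \<Rightarrow> nat \<Rightarrow> bool"
  assumes "\<And>a. a < n \<Longrightarrow> \<exists>b. \<not> S a b"
  shows "\<forall>\<^sub>F j in sequentially. \<forall>a<n. \<exists>b<j. \<not> S a b"
proof -
  have "\<forall>\<^sub>F j in sequentially. \<exists>b<j. \<not> S a b" if "a < n" for a
    using assms[OF that] eventually_gt_at_top by (blast intro: eventually_mono)
  then have "\<forall>\<^sub>F j in sequentially. \<forall>a\<in>{..<n}. \<exists>b<j. \<not> S a b"
    by (intro eventually_ball_finite ballI) auto
  then show ?thesis by (simp add: Ball_def)
qed

lemma eventually_believes_iff:
  assumes "(\<exists>a. \<forall>b. S a b) \<longleftrightarrow> \<not> (\<exists>a. \<forall>b. T a b)"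
  shows "\<forall>\<^sub>F j in sequentially. believes S T j \<longleftrightarrow> (\<exists>a. \<forall>b. S a b)"
proof (cases "\<exists>a. \<forall>b. S a b")
  case True
  then obtain a where a: "\<And>b. S a b" by blast
  have "\<forall>\<^sub>F j in sequentially. \<forall>a'<a. \<exists>b<j. \<not> T a' b"
    by (rule eventually_refuted) (use assms True in blast)
  then show ?thesis
    using eventually_gt_at_top[of a]
    by eventually_elim (use a True in \<open>auto simp: believes_def\<close>)
next
  case False
  then obtain a where a: "\<And>b. T a b" using assms by blast
  have "\<forall>\<^sub>F j in sequentially. \<forall>a'<Suc a. \<exists>b<j. \<not> S a' b"
    by (rule eventually_refuted) (use False in blast)
  then show ?thesis
    by eventually_elim (metis a False believes_def less_Suc_eq not_less_iff_gr_or_eq)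
qed

lemma believes_cong:
  assumes "\<And>a b. a < j \<Longrightarrow> b < j \<Longrightarrow> S a b = S' a b"
    and "\<And>a b. a < j \<Longrightarrow> b < j \<Longrightarrow> T a b = T' a b"
  shows "believes S T j = believes S' T' j"
  unfolding believes_def using assms by (metis less_trans)

lemma eventually_believes_cong:
  assumes "\<And>a b. \<forall>\<^sub>F t in F. S t a b = S' a b" "\<And>a b. \<forall>\<^sub>F t in F. T t a b = T' a b"
  shows "\<forall>\<^sub>F t in F. believes (S t) (T t) j = believes S' T' j"
proof -
  have "\<forall>\<^sub>F t in F. \<forall>a\<in>{..<j}. \<forall>b\<in>{..<j}. S t a b = S' a b \<and> T t a b = T' a b"
    using assms by (intro eventually_ball_finite ballI eventually_conj) auto
  then show ?thesis by eventually_elim (rule believes_cong; simp)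
qed

definition confirmed :: "nat \<Rightarrow> nat \<Rightarrow> nat \<Rightarrow> nat \<Rightarrow> nat \<Rightarrow> nat \<Rightarrow> bool" where
  "confirmed t p z x a b \<longleftrightarrow>
     (\<exists>d<t. eval_code p (list_encode [x, a, b, d]) z \<in> set_decode (stage t))"

lemma eventually_confirmed_iff:
  "\<forall>\<^sub>F t in sequentially. confirmed t (recf_code p) z x a b \<longleftrightarrow> (\<exists>d. eval p [x, a, b, d] z)"
  using eventually_evaluated_iff[of p "[x, a, b]" z]
  unfolding confirmed_def evaluated_def by simp

text \<open>
  The code \<open>e\<close> is a pair of programs, for the matrix of a \<open>\<Sigma>\<^sub>3\<close> and of a \<open>\<Pi>\<^sub>3\<close> definition of the
  same set.
\<close>

definition guess :: "nat \<Rightarrow> nat \<Rightarrow> nat \<Rightarrow> nat \<Rightarrow> bool" where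
  "guess e x j t \<longleftrightarrow> believes (confirmed t (pfst e) 1 x) (confirmed t (psnd e) 0 x) j"

lemma recursive_guess: "recursive_rel4 guess"
  by (rule recursive_rel4I)
    (unfold guess_def believes_def confirmed_def list_encode.simps, intro computable_intros)

lemma recursive_rel4_program:
  assumes "recursive_rel4 P"
  obtains p where "\<And>x a b d z. eval p [x, a, b, d] z \<longleftrightarrow> of_bool (P x a b d) = z"
proof -
  from assms obtain p where "\<And>x a b d. eval p [x, a, b, d] (of_bool (P x a b d))"
    unfolding recursive_rel4_def of_bool_def by blast
  then have "eval p [x, a, b, d] z \<longleftrightarrow> of_bool (P x a b d) = z" for x a b d z
    using eval_deterministic by blast
  then show thesis by (rule that)
qed

lemma Delta3_double_limit:
  assumes "Delta3 A"
  shows "\<exists>e. double_limit (guess e) A"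
proof -
  from assms obtain P Q where recursive: "recursive_rel4 P" "recursive_rel4 Q"
    and P: "\<And>x. x \<in> A \<longleftrightarrow> (\<exists>a. \<forall>b. \<exists>d. P x a b d)"
    and Q: "\<And>x. x \<in> A \<longleftrightarrow> (\<forall>a. \<exists>b. \<forall>d. Q x a b d)"
    unfolding Delta3_def Sigma3_def Pi3_def by blast
  obtain p where p: "\<And>x a b d z. eval p [x, a, b, d] z \<longleftrightarrow> of_bool (P x a b d) = z"
    using recursive_rel4_program[OF recursive(1)] by blast
  obtain q where q: "\<And>x a b d z. eval q [x, a, b, d] z \<longleftrightarrow> of_bool (Q x a b d) = z"
    using recursive_rel4_program[OF recursive(2)] by blast
  let ?e = "prod_encode (recf_code p, recf_code q)"
  have "\<forall>\<^sub>F j in sequentially. \<forall>\<^sub>F t in sequentially. guess ?e x j t \<longleftrightarrow> x \<in> A" for x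
  proof -
    let ?S = "\<lambda>a b. \<exists>d. P x a b d" and ?T = "\<lambda>a b. \<exists>d. \<not> Q x a b d"
    have limit: "\<forall>\<^sub>F t in sequentially. guess ?e x j t \<longleftrightarrow> believes ?S ?T j" for j
      using eventually_confirmed_iff[of p 1 x] eventually_confirmed_iff[of q 0 x]
      unfolding guess_def prod_encode_inverse fst_conv snd_conv
      by (intro eventually_believes_cong) (simp_all add: p q del: One_nat_def)
    have "\<forall>\<^sub>F j in sequentially. believes ?S ?T j \<longleftrightarrow> x \<in> A"
      unfolding P by (rule eventually_believes_iff) (use P Q in auto)
    then show ?thesis
    proof eventually_elim
      case (elim j)
      then show ?case using limit[of j] by simp
    qed
  qed
  then show ?thesis unfolding double_limit_def by blast
qed

subsection \<open>The theorem\<close>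

lemma weak_apart_lam_unbounded:
  assumes "infinite A" "weak_apart A"
  shows "\<exists>w\<in>A. l \<le> lam w"
proof (rule ccontr)
  assume "\<not> ?thesis"
  then have "A \<subseteq> (\<Union>k<l. {x \<in> A. lam x = k})" by auto
  moreover have "finite (\<Union>k<l. {x \<in> A. lam x = k})"
    using assms(2) by (auto simp: weak_apart_def)
  ultimately show False using assms(1) finite_subset by blast
qed

lemma sum_mem_FS3:
  assumes "x \<in> A" "y \<in> A" "z \<in> A" "x < y" "y < z"
  shows "y + z \<in> FS3 A" "x + y + z \<in> FS3 A"
proof -
  have "\<Sum>{y, z} = y + z" "\<Sum>{x, y, z} = x + y + z" "card {y, z} \<le> 3" "card {x, y, z} \<le> 3"
    using assms(4,5) by auto
  then show "y + z \<in> FS3 A" "x + y + z \<in> FS3 A"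
    unfolding FS3_def using assms(1-3)
    by (metis (mono_tags, lifting) CollectI empty_subsetI finite.intros insert_not_empty
        insert_subset)+
qed

theorem theorem2p7:
  shows "\<exists>r::nat. r \<ge> 2 \<and> (\<exists>c :: nat \<Rightarrow> nat. recursive_fun c \<and> (\<forall>n. c n < r) \<and>
     (\<forall>A :: nat set. A \<subseteq> {0<..} \<and> infinite A \<and> Delta3 A \<and> weak_apart A \<longrightarrow>
        (\<exists>x \<in> A. \<exists>w1 \<in> A. \<exists>w2 \<in> A. x \<lless> w1 \<and> w1 \<lless> w2 \<and> c (w1 + w2) \<noteq> c (x + w1 + w2))
        \<and> \<not> (\<exists>k. \<forall>y \<in> FS3 A. c y = k)))"
proof (intro exI[of _ 2] conjI exI[of _ "color (served_at guess)"] allI impI)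
  show "recursive_fun (color (served_at guess))"
    by (intro recursive_color decidable_served_at recursive_guess)
  show "color (served_at guess) n < 2" for n by (simp add: color_def)
next
  fix A :: "nat set"
  assume A: "A \<subseteq> {0<..} \<and> infinite A \<and> Delta3 A \<and> weak_apart A"
  then obtain e where "double_limit (guess e) A" using Delta3_double_limit by blast
  moreover have "inj_on mu A" using A by (simp add: weak_apart_def inj_on_def)
  ultimately show "\<exists>x\<in>A. \<exists>w1\<in>A. \<exists>w2\<in>A. x \<lless> w1 \<and> w1 \<lless> w2 \<and>
      color (served_at guess) (w1 + w2) \<noteq> color (served_at guess) (x + w1 + w2)"
    using A by (intro color_served_at_neq weak_apart_lam_unbounded) auto
  then show "\<not> (\<exists>k. \<forall>y\<in>FS3 A. color (served_at guess) y = k)"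
    using sum_mem_FS3 unfolding ll_def by metis
qed simp

end
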